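(* Let $K$ be the number of computing nodes and $r$ the computation load, where $r\mid K$, and let $\eta_1$ be a positive integer. Let $N_1=\binom Kr\eta_1$ be the number of input files required by the homogeneous coded distributed computing scheme of Li et al., and let $N_{\rm c}=\left(\frac Kr\right)^r\eta_1$ be the number of input files required by the homogeneous hypercube scheme. Assuming $r=\Theta(K)$, $$\frac{N_1}{N_{\rm c}}=\frac{\binom Kr}{\left(\frac Kr\right)^r}=\Theta\left(\sqrt{\frac1K}\cdot\left(\frac{K}{K-r}\right)^{K}\right).$$ When $r<K$, this quantity grows exponentially with $K$; therefore the hypercube scheme has an exponential decrease in the number of required files compared with the scheme of Li et al.
   Context: In both schemes, $K$ nodes jointly compute output functions of a library of input files by a MapReduce procedure with a coded shuffle phase. The computation load $r$ is the total number of files stored across all nodes (with multiplicity) divided by the number of files. In the scheme of Li et al., each batch of $\eta_1$ files is placed at a distinct $r$-subset of the $K$ nodes. In the hypercube scheme, the nodes are split into $r$ disjoint sets of size $K/r$, and each batch of $\eta_1$ files is placed at a distinct group of $r$ nodes containing exactly one node from each set. $\Theta(\cdot)$ is the usual asymptotic notation as $K\to\infty$.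
   Formalization: The exponent K in the Θ-expression is corrected to K−r (as printed it fails, e.g. for K=2m, r=m), and the Θ-claim, like the growth claims, is made for r<K (for all large K), since K/(K−r) is undefined at r=K. *)

theory Defs
  imports Complex_Main "HOL-Library.FuncSet" "HOL-Library.Landau_Symbols"
begin

text \<open>
  \<open>K\<close> is the number of computing nodes, \<open>r\<close> the computation load and \<open>\<eta>\<close> the number of files in
  a batch. A scheme needs one batch for every group of nodes it uses for file placement.
\<close>

definition li_files :: "nat \<Rightarrow> nat \<Rightarrow> nat \<Rightarrow> nat" where
  "li_files K r \<eta> = (K choose r) * \<eta>"

text \<open>The integer division is exact in the intended case \<open>r dvd K\<close>.\<close>

definition hypercube_files :: "nat \<Rightarrow> nat \<Rightarrow> nat \<Rightarrow> nat" where
  "hypercube_files K r \<eta> = (K div r) ^ r * \<eta>"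

text \<open>
  The two formulas count what they should: all \<open>r\<close>-subsets of the nodes, respectively all groups
  with exactly one node from each of \<open>r\<close> disjoint sets of \<open>K / r\<close> nodes.
\<close>

lemma li_files_eq_card:
  assumes "finite V" and "card V = K"
  shows "li_files K r \<eta> = card {S. S \<subseteq> V \<and> card S = r} * \<eta>"
  using assms by (simp add: li_files_def n_subsets)

lemma hypercube_files_eq_card:
  fixes P :: "nat \<Rightarrow> 'v set"
  assumes size: "\<And>i. i < r \<Longrightarrow> card (P i) = K div r"
    and disj: "\<And>i j. i < r \<Longrightarrow> j < r \<Longrightarrow> i \<noteq> j \<Longrightarrow> P i \<inter> P j = {}"
  shows "hypercube_files K r \<eta> =
    card {S. S \<subseteq> (\<Union>i<r. P i) \<and> (\<forall>i<r. card (S \<inter> P i) = 1)} * \<eta>"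
proof -
  let ?F = "Pi\<^sub>E {..<r} P" and ?T = "{S. S \<subseteq> (\<Union>i<r. P i) \<and> (\<forall>i<r. card (S \<inter> P i) = 1)}"
  have meet: "f ` {..<r} \<inter> P i = {f i}" if "f \<in> ?F" "i < r" for f i
  proof
    show "{f i} \<subseteq> f ` {..<r} \<inter> P i" using that by auto
    show "f ` {..<r} \<inter> P i \<subseteq> {f i}"
    proof
      fix x assume "x \<in> f ` {..<r} \<inter> P i"
      then obtain j where j: "j < r" "x = f j" "x \<in> P i" by auto
      have "f j \<in> P j" using that(1) j(1) by (auto dest: PiE_mem)
      then show "x \<in> {f i}" using disj[of i j] j that(2) by (cases "i = j") auto
    qed
  qed
  have "bij_betw (\<lambda>f. f ` {..<r}) ?F ?T"
    unfolding bij_betw_def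
  proof
    show "inj_on (\<lambda>f. f ` {..<r}) ?F"
    proof (rule inj_onI)
      fix f g assume fg: "f \<in> ?F" "g \<in> ?F" "f ` {..<r} = g ` {..<r}"
      show "f = g"
      proof (rule PiE_ext[OF fg(1,2)])
        fix i assume "i \<in> {..<r}"
        then show "f i = g i" using meet[OF fg(1), of i] meet[OF fg(2), of i] fg(3) by auto
      qed
    qed
    show "(\<lambda>f. f ` {..<r}) ` ?F = ?T"
    proof
      show "(\<lambda>f. f ` {..<r}) ` ?F \<subseteq> ?T"
      proof
        fix S assume "S \<in> (\<lambda>f. f ` {..<r}) ` ?F"
        then obtain f where f: "f \<in> ?F" "S = f ` {..<r}" by auto
        have "S \<subseteq> (\<Union>i<r. P i)" using f by (auto dest: PiE_mem)
        then show "S \<in> ?T" using meet[OF f(1)] f(2) by simp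
      qed
      show "?T \<subseteq> (\<lambda>f. f ` {..<r}) ` ?F"
      proof
        fix S assume S: "S \<in> ?T"
        then have "\<forall>i. \<exists>x. i < r \<longrightarrow> S \<inter> P i = {x}" by (auto simp: card_1_singleton_iff)
        then obtain h where h: "\<And>i. i < r \<Longrightarrow> S \<inter> P i = {h i}" by metis
        let ?f = "restrict h {..<r}"
        have "?f \<in> ?F" using h by auto
        moreover have "S = ?f ` {..<r}"
        proof
          show "S \<subseteq> ?f ` {..<r}"
          proof
            fix x assume x: "x \<in> S"
            then obtain i where "i < r" "x \<in> P i" using S by auto
            then show "x \<in> ?f ` {..<r}" using h[of i] x by auto
          qed
          show "?f ` {..<r} \<subseteq> S" using h by auto
        qed
        ultimately show "S \<in> (\<lambda>f. f ` {..<r}) ` ?F" by blast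
      qed
    qed
  qed
  then have "card ?T = card ?F" by (simp add: bij_betw_same_card)
  also have "\<dots> = (K div r) ^ r" by (simp add: card_PiE size)
  finally show ?thesis by (simp add: hypercube_files_def)
qed

text \<open>\<open>f\<close> is exponential in \<open>K\<close> along a sequence of instances with \<open>K n\<close> nodes.\<close>

definition grows_exponentially :: "(nat \<Rightarrow> real) \<Rightarrow> (nat \<Rightarrow> nat) \<Rightarrow> bool" where
  "grows_exponentially f K \<longleftrightarrow>
    (\<exists>a b. 1 < a \<and> 1 < b \<and> f \<in> \<Omega>(\<lambda>n. a ^ K n) \<and> f \<in> O(\<lambda>n. b ^ K n))"

definition decays_exponentially :: "(nat \<Rightarrow> real) \<Rightarrow> (nat \<Rightarrow> nat) \<Rightarrow> bool" where
  "decays_exponentially f K \<longleftrightarrow> (\<exists>q. 0 < q \<and> q < 1 \<and> f \<in> O(\<lambda>n. q ^ K n))"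

end

theory Submission
  imports Defs "HOL-Analysis.Harmonic_Numbers"
begin

text \<open>
  Stirling bounds give, uniformly for \<open>0 < k < n\<close>,
  \<open>(n choose k) / (n / k) ^ k \<asymp> sqrt (n / (k (n - k))) (n / (n - k)) ^ (n - k)\<close>.
  If \<open>k\<close> is a proper divisor of \<open>n\<close> then \<open>k \<le> n / 2\<close>; together with \<open>c n \<le> k\<close> this makes the square
  root comparable to \<open>sqrt (1 / n)\<close>. The power is at most \<open>2 ^ n\<close>, and at least
  \<open>(1 + c) ^ (n - k) \<ge> sqrt (1 + c) ^ n\<close>, of which one more square root is given away to absorb
  \<open>sqrt (1 / n)\<close>.
\<close>

section \<open>Stirling bounds for factorials and binomial coefficients\<close>

text \<open>At \<open>n = 1\<close> the quantity is exactly 1. Each step lowers it by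
  \<open>(x + 1/2) * D - 1\<close>, which lies between 0 and a telescoping difference; the term
  \<open>1 / (4 * real n)\<close> carries the telescoped sum through the induction.\<close>

lemma ln_fact_bounds:
  fixes n :: nat
  assumes "n > 0"
  shows "ln (fact n) - (real n + 1/2) * ln (real n) + real n \<in> {3/4 + 1 / (4 * real n)..1}"
  using assms
proof (induction n rule: nat_induct_non_zero)
  case 1
  then show ?case by simp
next
  case (Suc n)
  define x where "x = real n"
  have x: "x > 0" using Suc by (simp add: x_def)
  define D where "D = ln (x + 1) - ln x"
  have "ln (fact (Suc n)) = ln (x + 1) + ln (fact n)"
    using x by (simp add: ln_mult x_def add.commute del: of_nat_Suc)
  then have step: "ln (fact (Suc n)) - (real (Suc n) + 1/2) * ln (real (Suc n)) + real (Suc n) =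
      ln (fact n) - (x + 1/2) * ln x + x - ((x + 1/2) * D - 1)"
    by (simp add: D_def x_def algebra_simps)
  \<comment> \<open>The midpoint rule underestimates the integral \<open>D\<close> of the convex
    function 1/t over [x, x + 1].\<close>
  have "2 / (2 * x + 1) \<le> D"
    using ln_inverse_approx_ge[of x "x + 1"] x by (simp add: D_def)
  then have lower: "1 \<le> (x + 1/2) * D"
    using x by (simp add: field_simps)
  \<comment> \<open>The trapezoid rule overestimates the same integral; its excess after scaling is
    1 / (4 x (x + 1)), which splits into the telescoping difference below.\<close>
  have "D \<le> (inverse x + inverse (x + 1)) / 2"
    using ln_inverse_approx_le[of x 1] x by (simp add: D_def)
  then have "(x + 1/2) * D \<le> (x + 1/2) * ((inverse x + inverse (x + 1)) / 2)"
    using x by (intro mult_left_mono) auto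
  also have "\<dots> = 1 + 1 / (4 * x) - 1 / (4 * (x + 1))"
    using x by (simp add: divide_simps) (simp add: algebra_simps)
  finally have upper: "(x + 1/2) * D \<le> 1 + 1 / (4 * x) - 1 / (4 * (x + 1))" .
  have "3/4 + 1 / (4 * x) \<le> ln (fact n) - (x + 1/2) * ln x + x"
    "ln (fact n) - (x + 1/2) * ln x + x \<le> 1"
    using Suc.IH by (simp_all add: x_def)
  moreover have "1 / (4 * real (Suc n)) = 1 / (4 * (x + 1))" by (simp add: x_def)
  ultimately show ?case
    unfolding atLeastAtMost_iff step using lower upper by linarith
qed

text \<open>The constants \<open>exp (3/4)\<close> and \<open>exp 1\<close> enclose the sharp
  Stirling constant sqrt (2 pi); any fixed pair is enough for \<Theta>.\<close>

lemma fact_stirling_bounds: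
  fixes n :: nat
  assumes "n > 0"
  defines "S \<equiv> sqrt (real n) * real n ^ n / exp (real n)"
  shows "exp (3/4) * S \<le> fact n" "fact n \<le> exp 1 * S"
proof -
  define d where "d = ln (fact n) - (real n + 1/2) * ln (real n) + real n"
  have "ln S = (real n + 1/2) * ln (real n) - real n"
    using assms by (simp add: S_def ln_mult ln_div ln_sqrt ln_realpow algebra_simps)
  moreover have S: "S > 0" using assms by (simp add: S_def)
  ultimately have "ln (fact n) = d + ln S" by (simp add: d_def)
  then have "exp (ln (fact n)) = exp (d + ln S)" by (rule arg_cong)
  also have "\<dots> = exp d * S" using S by (subst exp_add) simp
  finally have "exp (ln (fact n)) = exp d * S" .
  then have "fact n = exp d * S" by simp
  moreover have "0 \<le> 1 / (4 * real n)" by simp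
  then have "3/4 \<le> d" "d \<le> 1"
    using ln_fact_bounds[OF assms(1), folded d_def] unfolding atLeastAtMost_iff by linarith+
  ultimately show "exp (3/4) * S \<le> fact n" "fact n \<le> exp 1 * S"
    using S by simp_all
qed

text \<open>In the quotient of Stirling terms the exponentials cancel because n = k + (n - k), and
  dividing by (n / k) ^ k removes \<open>k ^ k\<close> and \<open>n ^ k\<close>. Only the power with
  exponent \<open>n - k\<close> and the square root survive.\<close>

lemma binomial_stirling_bounds:
  fixes n k :: nat
  assumes k: "0 < k" "k < n"
  defines "B \<equiv> sqrt (real n / (real k * (real n - real k))) *
      (real n / (real n - real k)) ^ (n - k)"
  shows "exp (- 5/4) * B \<le> real (n choose k) / (real n / real k) ^ k"
    and "real (n choose k) / (real n / real k) ^ k \<le> B"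
proof -
  define S where "S m = sqrt (real m) * real m ^ m / exp (real m)" for m :: nat
  have S: "S m > 0" if "m > 0" for m using that by (simp add: S_def)
  have lo: "exp (3/4) * S m \<le> fact m" and hi: "fact m \<le> exp 1 * S m" if "m > 0" for m
    using fact_stirling_bounds[OF that] by (simp_all add: S_def)
  define q where "q = (real n / real k) ^ k"
  have q: "q > 0" using k by (simp add: q_def)
  define l where "l = n - k"
  have l: "l > 0" "n = k + l" using k by (simp_all add: l_def)
  have B: "S n / (S k * S l) / q = B"
    using l k by (simp add: B_def S_def q_def exp_add power_add power_divide real_sqrt_divide
        real_sqrt_mult field_simps)
  have choose: "real (n choose k) = fact n / (fact k * fact l)"
    using k by (simp add: binomial_fact l_def)
  have "exp (3/4) * S n / ((exp 1 * S k) * (exp 1 * S l)) \<le> fact n / (fact k * fact l)"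
    using k l S by (intro frac_le mult_mono lo hi mult_nonneg_nonneg) (auto intro: less_imp_le)
  \<comment> \<open>The exponent is 3/4 - 1 - 1 = -5/4.\<close>
  moreover have "exp (3/4) * S n / ((exp 1 * S k) * (exp 1 * S l)) =
      exp (- 5/4) * (S n / (S k * S l))"
  proof -
    have "exp (3/4) = exp (- 5/4) * (exp 1 * exp (1::real))"
      by (simp flip: exp_add)
    then show ?thesis by simp
  qed
  ultimately have "exp (- 5/4) * (S n / (S k * S l)) \<le> real (n choose k)"
    using choose by simp
  from divide_right_mono[OF this less_imp_le[OF q]]
  show "exp (- 5/4) * B \<le> real (n choose k) / (real n / real k) ^ k"
    by (simp flip: B q_def)
  have "fact n / (fact k * fact l) \<le> exp 1 * S n / ((exp (3/4) * S k) * (exp (3/4) * S l))"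
    using k l S by (intro frac_le mult_mono lo hi mult_nonneg_nonneg) (auto intro!: mult_pos_pos less_imp_le)
  \<comment> \<open>The exponent is 1 - 3/4 - 3/4 = -1/2; the factor is then rounded up to
    1.\<close>
  also have "\<dots> = exp (- 1/2) * (S n / (S k * S l))"
  proof -
    have "exp 1 = exp (- 1/2) * (exp (3/4) * exp (3/4::real))"
      by (simp flip: exp_add)
    then show ?thesis by simp
  qed
  also have "\<dots> \<le> 1 * (S n / (S k * S l))"
    using S k l by (intro mult_right_mono) (auto intro!: less_imp_le)
  finally have "real (n choose k) \<le> S n / (S k * S l)"
    using choose by simp
  from divide_right_mono[OF this less_imp_le[OF q]]
  show "real (n choose k) / (real n / real k) ^ k \<le> B"
    by (simp flip: B q_def)
qed

section \<open>Estimates for a load proportional to the number of nodes\<close>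

lemma binomial_ratio_bounds:
  fixes n k :: nat and c :: real
  assumes c: "0 < c" "c * real n \<le> real k" and k: "0 < k" "2 * k \<le> n"
  defines "T \<equiv> sqrt (1 / real n) * (real n / (real n - real k)) ^ (n - k)"
  shows "exp (- 5/4) * T \<le> real (n choose k) / (real n / real k) ^ k"
    and "real (n choose k) / (real n / real k) ^ k \<le> sqrt (2 / c) * T"
proof -
  define x y where "x = real n" and "y = real k"
  have xy: "0 < y" "2 * y \<le> x" "c * x \<le> y"
    using k c by (simp_all add: x_def y_def)
  have "y * (x - y) \<le> x * x"
    using xy by (intro mult_mono) auto
  then have "1 / x \<le> x / (y * (x - y))"
    using xy by (simp add: field_simps)
  then have lo: "sqrt (1 / x) \<le> sqrt (x / (y * (x - y)))" by simp
  \<comment> \<open>Product of \<open>c * x \<le> y\<close> and \<open>x \<le> 2 * (x - y)\<close>,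
    the latter restating \<open>2 * y \<le> x\<close>; this yields the constant
    \<open>2 / c\<close>.\<close>
  have "c * x * x \<le> y * (2 * (x - y))"
    using xy c by (intro mult_mono) auto
  then have "x / (y * (x - y)) \<le> 2 / c * (1 / x)"
    using xy c by (simp add: field_simps)
  then have hi: "sqrt (x / (y * (x - y))) \<le> sqrt (2 / c) * sqrt (1 / x)"
    by (metis real_sqrt_le_mono real_sqrt_mult)
  let ?P = "(x / (x - y)) ^ (n - k)"
  have P: "?P \<ge> 0" using xy by simp
  have "k < n" using k by simp
  note bnd = binomial_stirling_bounds[OF k(1) this, folded x_def y_def]
  have "exp (- 5/4) * (sqrt (1 / x) * ?P) \<le> exp (- 5/4) * (sqrt (x / (y * (x - y))) * ?P)"
    using mult_right_mono[OF lo P] by simp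
  also note bnd(1)
  finally show "exp (- 5/4) * T \<le> real (n choose k) / (real n / real k) ^ k"
    by (simp add: T_def x_def y_def)
  note bnd(2)
  also have "sqrt (x / (y * (x - y))) * ?P \<le> sqrt (2 / c) * sqrt (1 / x) * ?P"
    by (rule mult_right_mono[OF hi P])
  finally show "real (n choose k) / (real n / real k) ^ k \<le> sqrt (2 / c) * T"
    by (simp add: T_def x_def y_def mult.assoc)
qed

lemma exponential_bounds:
  fixes n k :: nat and c :: real
  assumes c: "0 < c" "c * real n \<le> real k" and k: "0 < k" "2 * k \<le> n"
  defines "a \<equiv> sqrt (sqrt (1 + c))"
    and "T \<equiv> sqrt (1 / real n) * (real n / (real n - real k)) ^ (n - k)"
  shows "(a - 1) * a ^ n \<le> T" and "T \<le> 2 ^ n"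
proof -
  have kn: "real k < real n" using k by linarith
  have a: "a > 1" using c by (simp add: a_def)
  have a4: "1 + c = a ^ 4"
  proof -
    have "a ^ 4 = (a\<^sup>2)\<^sup>2" by simp
    then show ?thesis using c by (simp add: a_def)
  qed
  have sn: "sqrt (real n) \<ge> 1" using k by simp
  \<comment> \<open>By Bernoulli, \<open>a ^ n\<close> dominates (a - 1) n and hence (a - 1) sqrt n:
    one copy of \<open>a ^ n\<close> pays for the factor \<open>sqrt (1 / real n)\<close>, up to
    \<open>a - 1\<close>.\<close>
  have "(a - 1) * sqrt (real n) \<le> (a - 1) * real n"
  proof (intro mult_left_mono)
    have "sqrt (real n) * 1 \<le> sqrt (real n) * sqrt (real n)"
      using sn by (intro mult_left_mono) auto
    then show "sqrt (real n) \<le> real n" by simp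
  qed (use a in simp)
  also have "\<dots> \<le> a ^ n"
    using Bernoulli_inequality[of "a - 1" n] a by (simp add: mult.commute)
  finally have absorb: "a - 1 \<le> sqrt (1 / real n) * a ^ n"
    using sn by (simp add: real_sqrt_divide field_simps)
  \<comment> \<open>Equivalently n / (n - k) = 1 + k / (n - k) is at least 1 + c.\<close>
  have "c * (real n - real k) \<le> real k"
    using c by (smt (verit) mult_left_mono of_nat_0_le_iff)
  then have base: "a ^ 4 \<le> real n / (real n - real k)"
    unfolding a4[symmetric] using kn by (simp add: field_simps)
  \<comment> \<open>Since n - k is at least n / 2, the fourth root leaves two copies of
    \<open>a ^ n\<close>: one for the absorption above, one for the final bound.\<close>
  have "a ^ (2 * n) \<le> a ^ (4 * (n - k))"
    using a k by (intro power_increasing) auto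
  also have "\<dots> \<le> (real n / (real n - real k)) ^ (n - k)"
    unfolding power_mult using base a by (intro power_mono) auto
  finally have pow: "a ^ n * a ^ n \<le> (real n / (real n - real k)) ^ (n - k)"
    by (simp add: mult_2 power_add)
  have "(a - 1) * a ^ n \<le> sqrt (1 / real n) * a ^ n * a ^ n"
    using absorb a by (intro mult_right_mono) auto
  also have "\<dots> \<le> T"
    unfolding T_def mult.assoc using pow by (intro mult_left_mono) auto
  finally show "(a - 1) * a ^ n \<le> T" .
  have "real n / (real n - real k) \<le> 2"
    using k kn by (simp add: field_simps)
  then have "(real n / (real n - real k)) ^ (n - k) \<le> 2 ^ (n - k)"
    using kn by (intro power_mono) auto
  also have "\<dots> \<le> (2 :: real) ^ n" by (intro power_increasing) auto
  finally have "T \<le> 1 * 2 ^ n"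
    unfolding T_def using k kn by (intro mult_mono) auto
  then show "T \<le> 2 ^ n" by simp
qed

lemma proper_dvd_imp_double_le:
  fixes k n :: nat
  assumes "k dvd n" "k < n"
  shows "2 * k \<le> n"
proof -
  obtain m where m: "n = k * m" using assms by blast
  then have "2 \<le> m" using assms by (cases m; cases "m - 1") auto
  then show ?thesis using m by (simp add: mult.commute)
qed

section \<open>Asymptotics along a sequence of instances\<close>

text \<open>Sequences \<open>K\<close> and \<open>r\<close> let the load vary with the number of
  nodes under divisibility. The exponent is \<open>K n - r n\<close>: exponent \<open>K n\<close>
  would add (K / (K - r)) ^ r, exponentially large when r is at least c K. For r = K the ratio is 1,
  but the comparison term would be sqrt (1 / K), as x / 0 = 0 and 0 ^ 0 = 1; hence the premise
  \<open>r n < K n\<close>.\<close>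

theorem mainTheorem8:
  fixes K r :: "nat \<Rightarrow> nat" and \<eta> :: nat
  assumes K_pos: "\<And>n. K n > 0"
    and r_dvd_K: "\<And>n. r n dvd K n"
    and eta_pos: "\<eta> > 0"
    and K_at_top: "filterlim K at_top sequentially"
    and r_Theta_K: "(\<lambda>n. real (r n)) \<in> \<Theta>(\<lambda>n. real (K n))"
  defines "ratio \<equiv> (\<lambda>n. real (li_files (K n) (r n) \<eta>) / real (hypercube_files (K n) (r n) \<eta>))"
  shows "(\<forall>n. ratio n = real (K n choose r n) / (real (K n) / real (r n)) ^ r n) \<and>
    ((\<forall>\<^sub>F n in sequentially. r n < K n) \<longrightarrow>
      ratio \<in> \<Theta>(\<lambda>n. sqrt (1 / real (K n)) *
        (real (K n) / (real (K n) - real (r n))) ^ (K n - r n)) \<and>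
      grows_exponentially ratio K \<and>
      decays_exponentially
        (\<lambda>n. real (hypercube_files (K n) (r n) \<eta>) / real (li_files (K n) (r n) \<eta>)) K)"
proof (intro conjI allI impI)
  have r_pos: "r n > 0" for n 
    using K_pos[of n] r_dvd_K[of n] by (metis dvd_0_left_iff gr0I)
  define R where "R = (\<lambda>n. real (K n choose r n) / (real (K n) / real (r n)) ^ r n)"
  \<comment> \<open>Divisibility makes \<open>K n div r n\<close> exact, and \<eta> cancels.\<close>
  have ratio_n: "ratio n = R n" for n
    using eta_pos r_dvd_K[of n]
    by (simp add: ratio_def R_def li_files_def hypercube_files_def real_of_nat_div)
  then show "ratio n = real (K n choose r n) / (real (K n) / real (r n)) ^ r n" for n
    by (simp add: R_def)
  assume less: "\<forall>\<^sub>F n in sequentially. r n < K n"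
  have "(\<lambda>n. real (r n)) \<in> \<Omega>(\<lambda>n. real (K n))" using r_Theta_K by blast
  then obtain c where c: "c > 0" and c_le: "\<forall>\<^sub>F n in sequentially. c * real (K n) \<le> real (r n)"
    by (elim landau_omega.bigE) auto
  from less c_le have ev: "\<forall>\<^sub>F n in sequentially. 2 * r n \<le> K n \<and> c * real (K n) \<le> real (r n)"
    by eventually_elim (use r_dvd_K proper_dvd_imp_double_le in blast)
  define T where "T = (\<lambda>n. sqrt (1 / real (K n)) *
    (real (K n) / (real (K n) - real (r n))) ^ (K n - r n))"
  define a where "a = sqrt (sqrt (1 + c))"
  have a: "a > 1" using c by (simp add: a_def)
  have bounds: "\<forall>\<^sub>F n in sequentially. 0 \<le> T n \<and> exp (- 5/4) * T n \<le> ratio n \<and>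
      ratio n \<le> sqrt (2 / c) * T n \<and> (a - 1) * a ^ K n \<le> T n \<and> T n \<le> 2 ^ K n"
    using ev
  proof eventually_elim
    case (elim n)
    then have "2 * r n \<le> K n" "c * real (K n) \<le> real (r n)" by auto
    note h = c this(2) r_pos[of n] this(1)
    have low: "(a - 1) * a ^ K n \<le> T n"
      using exponential_bounds(1)[OF h] by (simp only: T_def a_def)
    then have "0 \<le> T n" using a by (smt (verit) zero_less_mult_iff zero_less_power)
    then show ?case
      using low binomial_ratio_bounds[OF h] exponential_bounds(2)[OF h]
      by (simp only: T_def R_def ratio_n simp_thms)
  qed
  have Theta_T: "ratio \<in> \<Theta>(T)"
  proof
    show "ratio \<in> O(T)"
      by (rule bigoI[of _ "sqrt (2 / c)"], use bounds in eventually_elim)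
        (smt (verit) exp_gt_zero mult_nonneg_nonneg real_norm_def)
    show "ratio \<in> \<Omega>(T)"
      by (rule landau_omega.bigI[of "exp (- 5/4)"], simp, use bounds in eventually_elim)
        (smt (verit) exp_gt_zero mult_nonneg_nonneg real_norm_def)
  qed
  then show "ratio \<in> \<Theta>(\<lambda>n. sqrt (1 / real (K n)) *
      (real (K n) / (real (K n) - real (r n))) ^ (K n - r n))"
    by (simp only: T_def)
  have "T \<in> O(\<lambda>n. 2 ^ K n)"
    by (rule bigoI[of _ 1], use bounds in eventually_elim) simp
  with Theta_T have upper: "ratio \<in> O(\<lambda>n. 2 ^ K n)"
    using landau_o.big_trans bigthetaD1 by blast
  have "T \<in> \<Omega>(\<lambda>n. a ^ K n)"
    by (rule landau_omega.bigI[of "a - 1"], use a in simp, use bounds in eventually_elim)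
      (use a in simp)
  with Theta_T have lower: "ratio \<in> \<Omega>(\<lambda>n. a ^ K n)"
    using landau_omega.big_trans bigthetaD2 by blast
  show "grows_exponentially ratio K"
    unfolding grows_exponentially_def
    by (rule exI[of _ a], rule exI[of _ 2]) (use a lower upper in simp)
  have nz: "\<forall>\<^sub>F n in sequentially. ratio n \<noteq> 0"
    using bounds
  proof eventually_elim
    case (elim n)
    have "0 < (a - 1) * a ^ K n" using a by simp
    with elim have "0 < exp (- 5/4) * T n" by simp
    with elim show ?case by linarith
  qed
  \<comment> \<open>Inversion of eventually nonzero functions reverses the lower bound, so the
    inverse ratio decays with \<open>q = inverse a\<close>.\<close>
  have "(\<lambda>n. inverse (ratio n)) \<in> O(\<lambda>n. inverse (a ^ K n))"
    using lower nz a by (subst landau_o.big.inverse) (auto simp: bigomega_iff_bigo)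
  then show "decays_exponentially
      (\<lambda>n. real (hypercube_files (K n) (r n) \<eta>) / real (li_files (K n) (r n) \<eta>)) K"
    unfolding decays_exponentially_def
    using a by (intro exI[of _ "inverse a"])
      (simp add: ratio_def power_inverse inverse_less_1_iff)
qed

end
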